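(* Let $n$ be a non-negative integer. For every $k\ge 1$ we have $N^{k}_{n}=N_{\Sigma_n}(N^{k-1}_{n})$. In particular, $N^{k}_{n}$ is a $2$-group.
   Context: Write $x^y=y^{-1}xy$. For $n\ge 0$ let $X_n=\{1,\dots,2^n\}$ and let $\mathrm{Sym}(2^n)$ be the symmetric group on $X_n$; for $m\le n$, $\mathrm{Sym}(2^m)$ is regarded as the subgroup of $\mathrm{Sym}(2^n)$ fixing every point greater than $2^m$. For $i\ge 1$ put $s_i=\prod_{j=1}^{2^{i-1}}(j,\,j+2^{i-1})$. Let $\Sigma_n=\langle s_1,\dots,s_n\rangle$, a Sylow $2$-subgroup of $\mathrm{Sym}(2^n)$. Define recursively $t^n_n=s_n$ and $t^n_i=t^{n-1}_i\cdot (t^{n-1}_i)^{s_n}$ for $1\le i<n$. Let $T_n=\langle t^n_1,\dots,t^n_n\rangle$, a regular elementary abelian subgroup of $\mathrm{Sym}(2^n)$ of order $2^n$ contained in $\Sigma_n$, and let $U_n=N_{\Sigma_n}(T_n)$. The normalizer chain is defined by $N^0_n=U_n$ and $N^k_n=N_{\mathrm{Sym}(2^n)}(N^{k-1}_n)$ for $k\ge 1$. *)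

theory Defs
  imports "HOL-Algebra.Algebra"
begin

text \<open>
  The product of \<open>sym_group\<close> is \<open>(\<circ>)\<close>, i.e. permutations act on the left. Formulas are written
  symbol by symbol as in the right-action convention; since the generators below are involutions
  and products of disjoint permutations, all objects are the same in either convention.
\<close>

abbreviation Sym2 :: "nat \<Rightarrow> (nat \<Rightarrow> nat) monoid"
  where "Sym2 n \<equiv> sym_group (2 ^ n)"

text \<open>\<open>x\<^sup>y = y\<^sup>-\<^sup>1 x y\<close>\<close>

definition conj_by :: "('a, 'b) monoid_scheme \<Rightarrow> 'a \<Rightarrow> 'a \<Rightarrow> 'a"
  where "conj_by G x y = inv\<^bsub>G\<^esub> y \<otimes>\<^bsub>G\<^esub> x \<otimes>\<^bsub>G\<^esub> y"

text \<open>
  The normalizer in \<open>K\<close> of a subset \<open>H\<close> of \<open>G\<close> that need not lie in \<open>K\<close>. The library's \<open>normalizer\<close>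
  for the group with carrier \<open>K\<close> is meaningful only for subsets of \<open>K\<close>.
\<close>

definition normalizer_in :: "('a, 'b) monoid_scheme \<Rightarrow> 'a set \<Rightarrow> 'a set \<Rightarrow> 'a set"
  where "normalizer_in G K H = K \<inter> normalizer G H"

definition is_p_group :: "nat \<Rightarrow> ('a, 'b) monoid_scheme \<Rightarrow> bool"
  where "is_p_group p G \<longleftrightarrow> group G \<and> (\<exists>m. order G = p ^ m)"

text \<open>Only used for \<open>i \<ge> 1\<close>. The transpositions are disjoint, so their order is irrelevant.\<close>

definition s :: "nat \<Rightarrow> nat \<Rightarrow> nat"
  where "s i = foldr (\<circ>) (map (\<lambda>j. transpose j (j + 2 ^ (i - 1))) [1..<2 ^ (i - 1) + 1]) id"

definition Sigma_grp :: "nat \<Rightarrow> (nat \<Rightarrow> nat) set"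
  where "Sigma_grp n = generate (Sym2 n) (s ` {1..n})"

text \<open>
  \<open>t n i\<close> is $t^n_i$, only used for \<open>1 \<le> i \<le> n\<close>. The smaller symmetric group is a subset of the
  larger one, because a permutation is a function on all of \<open>nat\<close> fixing the other points.
\<close>

primrec t :: "nat \<Rightarrow> nat \<Rightarrow> nat \<Rightarrow> nat"
  where
    "t 0 i = id"
  | "t (Suc n) i =
      (if i = Suc n then s (Suc n)
       else t n i \<otimes>\<^bsub>Sym2 (Suc n)\<^esub> conj_by (Sym2 (Suc n)) (t n i) (s (Suc n)))"

definition T_grp :: "nat \<Rightarrow> (nat \<Rightarrow> nat) set"
  where "T_grp n = generate (Sym2 n) (t n ` {1..n})"

definition U_grp :: "nat \<Rightarrow> (nat \<Rightarrow> nat) set"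
  where "U_grp n = normalizer_in (Sym2 n) (Sigma_grp n) (T_grp n)"

primrec norm_chain :: "nat \<Rightarrow> nat \<Rightarrow> (nat \<Rightarrow> nat) set"
  where
    "norm_chain n 0 = U_grp n"
  | "norm_chain n (Suc k) = normalizer (Sym2 n) (norm_chain n k)"

end

theory Submission
  imports Defs
begin

text \<open>
  Identify the point \<open>x\<close> with the bit vector \<open>x - 1\<close>. Then \<open>T_grp n\<close> is the group of all translations
  of the vector space of dimension \<open>n\<close> over the field with two elements (\<open>T_grp_eq\<close>), and
  \<open>Sigma_grp n\<close> is the iterated wreath product of groups of order 2, i.e. the group of all permutations
  that preserve, for every \<open>m\<close>, the partition of the points into consecutive intervals of length
  \<open>2 ^ m\<close> (\<open>Sigma_grp_eq_tree_auts\<close>). These intervals are the cosets of the subspaces of the standard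
  flag. The group \<open>U_grp n\<close> contains the translations and the elementary unitriangular maps.

  The point is that these partitions are the only ones invariant under \<open>U_grp n\<close>: an invariant
  partition consists, by translation, of the cosets of a subspace invariant under all unitriangular
  maps, and such a subspace belongs to the standard flag. Let \<open>N\<close> be a group between \<open>U_grp n\<close> and
  \<open>Sigma_grp n\<close>. Its invariant partitions are then exactly the partitions into intervals, one for each
  size of the classes. A permutation that normalizes \<open>N\<close> permutes the invariant partitions of \<open>N\<close>
  and preserves the size of classes, so it fixes each of these partitions, which means that it lies in
  \<open>Sigma_grp n\<close> (\<open>tree_aut_if_normalizes\<close>). By induction all terms of the normalizer chain lie
  between \<open>U_grp n\<close> and \<open>Sigma_grp n\<close>, whose order is a power of 2 (\<open>card_tree_auts\<close>).
\<close>

unbundle bit_operations_syntax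

section \<open>Invariant subspaces of the space of bit vectors\<close>

lemma less_two_power_iff_drop_bit:
  fixes u :: nat
  shows "u < 2 ^ n \<longleftrightarrow> drop_bit n u = 0"
  by (simp add: drop_bit_eq_div div_eq_0_iff)

lemma xor_less_two_power:
  fixes u v :: nat
  assumes "u < 2 ^ n" "v < 2 ^ n"
  shows "u XOR v < 2 ^ n"
  using assms by (simp add: less_two_power_iff_drop_bit)

lemma drop_bit_eq_mono:
  fixes u v :: nat
  assumes "drop_bit i u = drop_bit i v" "i \<le> m"
  shows "drop_bit m u = drop_bit m v"
proof -
  have "drop_bit (m - i) (drop_bit i u) = drop_bit (m - i) (drop_bit i v)"
    using assms(1) by simp
  then show ?thesis using assms(2) by simp
qed

lemma xor_two_power_lower:
  fixes u :: nat
  assumes "u < 2 ^ n"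
  shows "u XOR 2 ^ n = u + 2 ^ n"
proof -
  have "\<not> bit u n"
    using assms by (simp add: bit_iff_odd)
  then have "u AND 2 ^ n = 0"
    by (intro bit_eqI) (auto simp: bit_and_iff bit_exp_iff)
  then show ?thesis by (simp add: disjunctive_add_eq_xor)
qed

lemma xor_two_power_upper:
  fixes u :: nat
  assumes "2 ^ n \<le> u" "u < 2 ^ Suc n"
  shows "u XOR 2 ^ n = u - 2 ^ n"
proof -
  have "(u - 2 ^ n) XOR 2 ^ n = u"
    using assms by (subst xor_two_power_lower) auto
  then show ?thesis by (metis xor.assoc xor_self_eq xor.right_neutral)
qed

text \<open>
  The converse implication is the forward one applied to the images.
\<close>

lemma drop_bit_eq_iff_of_involution:
  fixes f :: "nat \<Rightarrow> nat"
  assumes "\<And>u. f (f u) = u"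
    and "\<And>m u v. drop_bit m u = drop_bit m v \<Longrightarrow> drop_bit m (f u) = drop_bit m (f v)"
  shows "drop_bit m (f u) = drop_bit m (f v) \<longleftrightarrow> drop_bit m u = drop_bit m v"
  using assms(2)[of m "f u" "f v"] assms(2)[of m u v] by (auto simp: assms(1))

text \<open>
  A natural number below \<open>2 ^ n\<close> stands for a vector over the field with two elements, its bits
  being the coordinates and \<open>XOR\<close> the addition. The map adds \<open>w\<close> to every vector whose
  coordinate \<open>i\<close> is 1. For \<open>w < 2 ^ i\<close> it is unitriangular: it modifies only coordinates below \<open>i\<close>.
\<close>

definition elem_transvection :: "nat \<Rightarrow> nat \<Rightarrow> nat \<Rightarrow> nat"
  where "elem_transvection i w u = (if bit u i then u XOR w else u)"

lemma elem_transvection_involution: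
  assumes "w < 2 ^ i"
  shows "elem_transvection i w (elem_transvection i w u) = u"
proof -
  have "\<not> bit w i"
    using assms by (simp add: bit_iff_odd)
  then show ?thesis
    by (simp add: elem_transvection_def bit_xor_iff xor.assoc)
qed

lemma elem_transvection_less:
  assumes "w < 2 ^ i" "u < 2 ^ n"
  shows "elem_transvection i w u < 2 ^ n"
proof (cases "bit u i")
  case True
  have "i < n"
  proof (rule ccontr)
    assume "\<not> i < n"
    then have "(2::nat) ^ n \<le> 2 ^ i" by simp
    then have "u < 2 ^ i" using assms(2) by linarith
    then show False using True by (simp add: bit_iff_odd)
  qed
  then have "(2::nat) ^ i \<le> 2 ^ n" by simp
  then have "w < 2 ^ n" using assms(1) by linarith
  then show ?thesis
    using assms(2) by (simp add: elem_transvection_def xor_less_two_power)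
qed (use assms in \<open>simp add: elem_transvection_def\<close>)

lemma elem_transvection_xor:
  assumes "w < 2 ^ i"
  shows "elem_transvection i w (u XOR v) = elem_transvection i w u XOR elem_transvection i w v"
  by (rule bit_eqI) (auto simp: elem_transvection_def bit_xor_iff)

text \<open>
  If \<open>m \<le> i\<close>, the bit that decides whether \<open>w\<close> is added is visible after dropping \<open>m\<close> bits;
  if \<open>m > i\<close>, all of \<open>w\<close> is dropped.
\<close>

lemma drop_bit_elem_transvection_iff:
  assumes "w < 2 ^ i"
  shows "drop_bit m (elem_transvection i w u) = drop_bit m (elem_transvection i w v) \<longleftrightarrow>
    drop_bit m u = drop_bit m v"
proof (rule drop_bit_eq_iff_of_involution)
  fix m u v :: nat
  assume eq: "drop_bit m u = drop_bit m v"
  show "drop_bit m (elem_transvection i w u) = drop_bit m (elem_transvection i w v)"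
  proof (cases "m \<le> i")
    case True
    have "bit u i = bit (drop_bit m u) (i - m)" "bit v i = bit (drop_bit m v) (i - m)"
      using True by (simp_all add: bit_drop_bit_eq)
    then show ?thesis using eq by (simp add: elem_transvection_def)
  next
    case False
    then have "drop_bit m w = 0"
      using drop_bit_eq_mono[of i w 0 m] assms by (simp add: less_two_power_iff_drop_bit)
    then show ?thesis using eq by (simp add: elem_transvection_def)
  qed
qed (rule elem_transvection_involution[OF assms])

lemma drop_bit_xor_iff:
  fixes a u v :: nat
  shows "drop_bit m (u XOR a) = drop_bit m (v XOR a) \<longleftrightarrow> drop_bit m u = drop_bit m v"
  by (rule drop_bit_eq_iff_of_involution) (simp_all add: xor.assoc)

text \<open>
  The unitriangular group has no invariant subspaces except those of the standard flag. The reason: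
  if \<open>i\<close> is the leading bit of \<open>v \<in> V\<close>, transvections move \<open>v\<close> to \<open>v XOR w\<close> for every \<open>w < 2 ^ i\<close>,
  so \<open>V\<close> contains all these \<open>w\<close>, and with \<open>v\<close> every vector with leading bit \<open>i\<close> too. Apply this to the
  largest element of \<open>V\<close>.
\<close>

lemma initial_segment_if_invariant_subspace:
  fixes V :: "nat set"
  assumes V: "V \<subseteq> {..<2 ^ n}" "0 \<in> V"
    and xor: "\<And>u v. u \<in> V \<Longrightarrow> v \<in> V \<Longrightarrow> u XOR v \<in> V"
    and transv: "\<And>i w v. i < n \<Longrightarrow> w < 2 ^ i \<Longrightarrow> v \<in> V \<Longrightarrow> elem_transvection i w v \<in> V"
  shows "\<exists>j\<le>n. V = {..<2 ^ j}"
proof (cases "V = {0}")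
  case True
  then have "V = {..<2 ^ 0}" by auto
  then show ?thesis by blast
next
  case False
  have fin: "finite V" using V(1) finite_subset by blast
  define v where "v = Max V"
  have v: "v \<in> V" using fin V(2) unfolding v_def by (intro Max_in) auto
  have "v \<noteq> 0"
  proof
    assume "v = 0"
    then have "V \<subseteq> {0}" using Max_ge[OF fin] unfolding v_def by fastforce
    then show False using False V(2) by blast
  qed
  then obtain i where i: "2 ^ i \<le> v" "v < 2 ^ (i + 1)"
    using ex_power_ivl1[of 2 v] by auto
  have "(2::nat) ^ i < 2 ^ n" using i v V(1) by (meson le_less_trans lessThan_iff subsetD)
  then have "i < n" by simp
  have "v div 2 ^ i = 1"
    using i by (intro div_nat_eqI) (auto simp: mult.commute)
  then have v1: "drop_bit i v = 1" by (simp add: drop_bit_eq_div)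
  then have "bit v i" by (simp add: bit_iff_odd_drop_bit)
  have low: "w \<in> V" if "w < 2 ^ i" for w
  proof -
    have "v XOR w \<in> V"
      using transv[OF \<open>i < n\<close> that v] \<open>bit v i\<close> by (simp add: elem_transvection_def)
    then have "v XOR (v XOR w) \<in> V" using xor v by blast
    then show ?thesis by (simp flip: xor.assoc)
  qed
  have "y \<in> V" if y: "y < 2 ^ Suc i" for y
  proof (cases "y < 2 ^ i")
    case False
    then have "y div 2 ^ i = 1"
      using y by (intro div_nat_eqI) (auto simp: mult.commute)
    then have "drop_bit i (v XOR y) = 0"
      using v1 by (simp add: drop_bit_eq_div[of _ y])
    then have "v XOR y \<in> V" by (simp add: low less_two_power_iff_drop_bit)
    then have "v XOR (v XOR y) \<in> V" using xor v by blast
    then show ?thesis by (simp flip: xor.assoc)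
  qed (rule low)
  moreover have "y < 2 ^ Suc i" if "y \<in> V" for y
    using Max_ge[OF fin that] i(2) unfolding v_def by simp
  ultimately have "V = {..<2 ^ Suc i}" by auto
  then show ?thesis using \<open>i < n\<close> by (metis Suc_leI)
qed

text \<open>
  An equivalence relation, given as equality of colours, that is invariant under translations
  consists of the cosets of the class of 0. That class is a subspace invariant under the transvections
  because they fix 0, so it belongs to the standard flag.
\<close>

lemma drop_bit_levels_if_invariant_colouring:
  fixes c :: "nat \<Rightarrow> 'c"
  assumes xor: "\<And>a u v. a < 2 ^ n \<Longrightarrow> u < 2 ^ n \<Longrightarrow> v < 2 ^ n \<Longrightarrow>
        c (u XOR a) = c (v XOR a) \<longleftrightarrow> c u = c v"
    and transv: "\<And>i w u v. i < n \<Longrightarrow> w < 2 ^ i \<Longrightarrow> u < 2 ^ n \<Longrightarrow> v < 2 ^ n \<Longrightarrow> 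
        c (elem_transvection i w u) = c (elem_transvection i w v) \<longleftrightarrow> c u = c v"
  shows "\<exists>j\<le>n. \<forall>u<2 ^ n. \<forall>v<2 ^ n. c u = c v \<longleftrightarrow> drop_bit j u = drop_bit j v"
proof -
  define V where "V = {u. u < 2 ^ n \<and> c u = c 0}"
  have "\<exists>j\<le>n. V = {..<2 ^ j}"
  proof (rule initial_segment_if_invariant_subspace)
    show "V \<subseteq> {..<2 ^ n}" "0 \<in> V" by (auto simp: V_def)
    show "u XOR v \<in> V" if "u \<in> V" "v \<in> V" for u v
      using that xor[of v u 0] by (auto simp: V_def xor_less_two_power)
    show "elem_transvection i w v \<in> V" if "i < n" "w < 2 ^ i" "v \<in> V" for i w v
      using that transv[of i w v 0] elem_transvection_less[of w i v n]
      by (auto simp: V_def elem_transvection_def[of _ _ 0])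
  qed
  then obtain j where j: "j \<le> n" "V = {..<2 ^ j}" by blast
  have "c u = c v \<longleftrightarrow> drop_bit j u = drop_bit j v" if "u < 2 ^ n" "v < 2 ^ n" for u v
  proof -
    have "c u = c v \<longleftrightarrow> u XOR v \<in> V"
      using xor[of v u v] that by (auto simp: V_def xor_less_two_power)
    also have "\<dots> \<longleftrightarrow> drop_bit j u XOR drop_bit j v = 0"
      by (simp add: j less_two_power_iff_drop_bit)
    also have "\<dots> \<longleftrightarrow> drop_bit j u = drop_bit j v"
      by (metis xor.assoc xor.left_neutral xor_self_eq)
    finally show ?thesis .
  qed
  with j(1) show ?thesis by blast
qed

section \<open>Automorphisms of the binary tree and their normalizers\<close>

text \<open>
  The position, counted from 0, of the interval of length \<open>2 ^ m\<close> that contains the point \<open>x\<close>;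
  points are numbered from 1. The intervals are the nodes of height \<open>m\<close> of a binary tree whose
  leaves are the points.
\<close>

definition block :: "nat \<Rightarrow> nat \<Rightarrow> nat"
  where "block m x = drop_bit m (x - 1)"

text \<open>
  The equivalence, instead of an implication, makes closure under inverses immediate.
\<close>

definition tree_auts :: "nat \<Rightarrow> (nat \<Rightarrow> nat) set"
  where "tree_auts n = {g. g permutes {1..2 ^ n} \<and>
    (\<forall>m. \<forall>x\<in>{1..2 ^ n}. \<forall>y\<in>{1..2 ^ n}. block m (g x) = block m (g y) \<longleftrightarrow> block m x = block m y)}"

text \<open>
  Transports a map of bit vectors, which start at 0, to the points, which start at 1.
\<close>

definition on_points :: "nat \<Rightarrow> (nat \<Rightarrow> nat) \<Rightarrow> nat \<Rightarrow> nat"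
  where "on_points n f x = (if x \<in> {1..2 ^ n} then Suc (f (x - 1)) else x)"

abbreviation translation :: "nat \<Rightarrow> nat \<Rightarrow> nat \<Rightarrow> nat"
  where "translation n a \<equiv> on_points n (\<lambda>u. u XOR a)"

abbreviation transvection :: "nat \<Rightarrow> nat \<Rightarrow> nat \<Rightarrow> nat \<Rightarrow> nat"
  where "transvection n i w \<equiv> on_points n (elem_transvection i w)"

lemma tree_autsD:
  assumes "g \<in> tree_auts n"
  shows "g permutes {1..2 ^ n}"
    and "x \<in> {1..2 ^ n} \<Longrightarrow> y \<in> {1..2 ^ n} \<Longrightarrow>
      block m (g x) = block m (g y) \<longleftrightarrow> block m x = block m y"
  using assms unfolding tree_auts_def by blast+

lemma tree_autsI:
  assumes "\<And>x. x \<in> {1..2 ^ n} \<Longrightarrow> g x \<in> {1..2 ^ n}" "\<And>x. x \<notin> {1..2 ^ n} \<Longrightarrow> g x = x"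
    and "\<And>m x y. x \<in> {1..2 ^ n} \<Longrightarrow> y \<in> {1..2 ^ n} \<Longrightarrow>
      block m (g x) = block m (g y) \<longleftrightarrow> block m x = block m y"
  shows "g \<in> tree_auts n"
proof -
  have "inj_on g {1..2 ^ n}"
  proof (rule inj_onI)
    fix x y :: nat assume xy: "x \<in> {1..2 ^ n}" "y \<in> {1..2 ^ n}" "g x = g y"
    then have "block 0 x = block 0 y" using assms(3)[of x y 0] by simp
    then have "x - 1 = y - 1" by (simp add: block_def)
    then show "x = y" using xy(1,2) by auto
  qed
  then have "g permutes {1..2 ^ n}"
    using assms(1,2) by (intro inj_imp_permutes) auto
  with assms(3) show ?thesis unfolding tree_auts_def by blast
qed

lemma on_points_in_tree_auts:
  assumes "\<And>u. u < 2 ^ n \<Longrightarrow> f u < 2 ^ n"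
    and "\<And>m u v. drop_bit m (f u) = drop_bit m (f v) \<longleftrightarrow> drop_bit m u = drop_bit m v"
  shows "on_points n f \<in> tree_auts n"
proof (rule tree_autsI)
  fix x :: nat assume "x \<in> {1..2 ^ n}"
  moreover from this have "x - 1 < 2 ^ n" by auto
  ultimately show "on_points n f x \<in> {1..2 ^ n}"
    using assms(1)[of "x - 1"] by (simp add: on_points_def Suc_le_eq)
qed (use assms(2) in \<open>auto simp: on_points_def block_def\<close>)

lemma on_points_comp:
  assumes "\<And>u. u < 2 ^ n \<Longrightarrow> g u < 2 ^ n"
  shows "on_points n f \<circ> on_points n g = on_points n (f \<circ> g)"
proof
  fix x
  show "(on_points n f \<circ> on_points n g) x = on_points n (f \<circ> g) x"
    using assms[of "x - 1"] by (cases x) (auto simp: on_points_def Suc_le_eq)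
qed

lemma translation_in_tree_auts:
  assumes "a < 2 ^ n"
  shows "translation n a \<in> tree_auts n"
proof (rule on_points_in_tree_auts)
  show "u XOR a < 2 ^ n" if "u < 2 ^ n" for u
    using that assms by (rule xor_less_two_power)
qed (rule drop_bit_xor_iff)

lemma transvection_in_tree_auts:
  assumes "w < 2 ^ i"
  shows "transvection n i w \<in> tree_auts n"
  by (rule on_points_in_tree_auts)
    (simp_all add: assms elem_transvection_less drop_bit_elem_transvection_iff)

lemma comp_in_tree_auts:
  assumes g: "g \<in> tree_auts n" and h: "h \<in> tree_auts n"
  shows "g \<circ> h \<in> tree_auts n"
proof (rule tree_autsI)
  have *: "h x \<in> {1..2 ^ n} \<longleftrightarrow> x \<in> {1..2 ^ n}" for x
    by (rule permutes_in_image[OF tree_autsD(1)[OF h]])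
  have **: "g x \<in> {1..2 ^ n} \<longleftrightarrow> x \<in> {1..2 ^ n}" for x
    by (rule permutes_in_image[OF tree_autsD(1)[OF g]])
  show "(g \<circ> h) x \<in> {1..2 ^ n}" if "x \<in> {1..2 ^ n}" for x
    using * ** that by simp
  show "(g \<circ> h) x = x" if "x \<notin> {1..2 ^ n}" for x
    using that by (simp only: comp_apply permutes_not_in[OF tree_autsD(1)[OF g]]
        permutes_not_in[OF tree_autsD(1)[OF h]] not_False_eq_True)
  show "block m ((g \<circ> h) x) = block m ((g \<circ> h) y) \<longleftrightarrow> block m x = block m y"
    if "x \<in> {1..2 ^ n}" "y \<in> {1..2 ^ n}" for m x y
    using tree_autsD(2)[OF g, of "h x" "h y" m] tree_autsD(2)[OF h, of x y m] that * by simp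
qed

lemma inv_in_tree_auts:
  assumes g: "g \<in> tree_auts n"
  shows "inv' g \<in> tree_auts n"
proof (rule tree_autsI)
  note p = tree_autsD(1)[OF g]
  have *: "inv' g x \<in> {1..2 ^ n} \<longleftrightarrow> x \<in> {1..2 ^ n}" for x
    by (rule permutes_in_image[OF permutes_inv[OF p]])
  show "inv' g x \<in> {1..2 ^ n}" if "x \<in> {1..2 ^ n}" for x
    using * that by simp
  show "inv' g x = x" if "x \<notin> {1..2 ^ n}" for x
    using that by (rule permutes_not_in[OF permutes_inv[OF p]])
  show "block m (inv' g x) = block m (inv' g y) \<longleftrightarrow> block m x = block m y"
    if "x \<in> {1..2 ^ n}" "y \<in> {1..2 ^ n}" for m x y
    using tree_autsD(2)[OF g, of "inv' g x" "inv' g y" m] that *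
    by (simp add: permutes_inverses[OF p])
qed

lemma subgroup_tree_auts: "subgroup (tree_auts n) (Sym2 n)"
proof
  show sub: "tree_auts n \<subseteq> carrier (Sym2 n)"
    using tree_autsD(1) by (auto simp: sym_group_carrier)
  show "\<one>\<^bsub>Sym2 n\<^esub> \<in> tree_auts n"
    unfolding sym_group_one by (rule tree_autsI) auto
  show "inv\<^bsub>Sym2 n\<^esub> g \<in> tree_auts n" if "g \<in> tree_auts n" for g
    using that sub inv_in_tree_auts by (simp add: subset_eq)
qed (simp add: sym_group_mult comp_in_tree_auts)

lemma finite_tree_auts: "finite (tree_auts n)"
proof -
  have "tree_auts n \<subseteq> {p. p permutes {1..2 ^ n}}" unfolding tree_auts_def by blast
  then show ?thesis by (rule finite_subset) (simp add: finite_permutations)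
qed

text \<open>
  Conjugation is injective, so on a finite set an inclusion is already an equality.
\<close>

lemma (in group) normalizer_iff_if_finite:
  assumes "H \<subseteq> carrier G" "finite H"
  shows "g \<in> normalizer G H \<longleftrightarrow> g \<in> carrier G \<and> (\<forall>h\<in>H. g \<otimes> h \<otimes> inv g \<in> H)"
proof (cases "g \<in> carrier G")
  case True
  have img: "g <# H #> inv g = (\<lambda>h. g \<otimes> h \<otimes> inv g) ` H"
    by (auto simp: l_coset_def r_coset_def)
  have inj: "inj_on (\<lambda>h. g \<otimes> h \<otimes> inv g) H"
  proof (rule inj_onI)
    fix h h' assume "h \<in> H" "h' \<in> H" "g \<otimes> h \<otimes> inv g = g \<otimes> h' \<otimes> inv g"
    moreover from this have "h \<in> carrier G" "h' \<in> carrier G" using assms(1) by auto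
    ultimately show "h = h'" using True by simp
  qed
  have "g \<in> normalizer G H \<longleftrightarrow> (\<lambda>h. g \<otimes> h \<otimes> inv g) ` H = H"
    using assms(1) True by (simp add: normalizer_def stabilizer_def img)
  also have "\<dots> \<longleftrightarrow> (\<forall>h\<in>H. g \<otimes> h \<otimes> inv g \<in> H)"
    using endo_inj_surj[OF assms(2) _ inj] by blast
  finally show ?thesis using True by simp
qed (simp add: normalizer_def stabilizer_def)

text \<open>
  The cardinality recovers \<open>m\<close> from the partition into intervals of length \<open>2 ^ m\<close>.
\<close>

lemma card_block:
  fixes b :: nat
  assumes "m \<le> n" "b < 2 ^ n"
  shows "card {v. v < 2 ^ n \<and> drop_bit m v = drop_bit m b} = 2 ^ m"
proof -
  define q where "q = b div 2 ^ m"
  have pow: "(2::nat) ^ n = 2 ^ (n - m) * 2 ^ m"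
    using assms(1) by (simp flip: power_add)
  then have "q < 2 ^ (n - m)"
    using assms(2) unfolding q_def by (intro less_mult_imp_div_less) simp
  then have q: "(q + 1) * 2 ^ m \<le> 2 ^ n"
    unfolding pow by (intro mult_le_mono1) simp
  have div: "v div 2 ^ m = q \<longleftrightarrow> v \<in> {q * 2 ^ m..<(q + 1) * 2 ^ m}" for v
  proof
    assume "v div 2 ^ m = q"
    then show "v \<in> {q * 2 ^ m..<(q + 1) * 2 ^ m}"
      using div_times_less_eq_dividend[of v "2 ^ m"] dividend_less_div_times[of "2 ^ m" v]
      by (simp add: algebra_simps)
  next
    assume "v \<in> {q * 2 ^ m..<(q + 1) * 2 ^ m}"
    then show "v div 2 ^ m = q"
      by (intro div_nat_eqI) (auto simp: algebra_simps)
  qed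
  have "{v. v < 2 ^ n \<and> drop_bit m v = drop_bit m b} = {q * 2 ^ m..<(q + 1) * 2 ^ m}"
    unfolding drop_bit_eq_div q_def[symmetric] div using q
    by (auto simp del: mult_Suc add_mult_distrib)
  then show ?thesis by simp
qed

text \<open>
  The heart of the argument. Pull the partition into blocks of level \<open>m\<close> back along \<open>g\<close>. Since \<open>N\<close>
  preserves the blocks and \<open>g\<close> normalizes \<open>N\<close>, the pulled back partition is again invariant under
  \<open>N\<close>, in particular under translations and transvections. Hence it is the partition into blocks
  of some level \<open>j\<close>, and \<open>j = m\<close> because \<open>g\<close> preserves the size of the classes.
\<close>

lemma tree_aut_if_normalizes:
  assumes N: "N \<subseteq> tree_auts n"
    and transl: "\<And>a. a < 2 ^ n \<Longrightarrow> translation n a \<in> N"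
    and transv: "\<And>i w. i < n \<Longrightarrow> w < 2 ^ i \<Longrightarrow> transvection n i w \<in> N"
    and g: "g permutes {1..2 ^ n}"
    and norm: "\<And>h. h \<in> N \<Longrightarrow> g \<circ> h \<circ> inv' g \<in> N"
  shows "g \<in> tree_auts n"
proof (rule tree_autsI)
  have g_in: "g x \<in> {1..2 ^ n} \<longleftrightarrow> x \<in> {1..2 ^ n}" for x
    by (rule permutes_in_image[OF g])
  show "g x \<in> {1..2 ^ n}" if "x \<in> {1..2 ^ n}" for x
    using that g_in by simp
  show "g x = x" if "x \<notin> {1..2 ^ n}" for x
    using that by (rule permutes_not_in[OF g])
  fix m x y :: nat assume xy: "x \<in> {1..2 ^ n}" "y \<in> {1..2 ^ n}"
  \<comment> \<open>The pulled back partition is invariant under \<open>N\<close>: \<open>g \<circ> h\<close> is \<open>h' \<circ> g\<close> with \<open>h' \<in> N\<close>.\<close>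
  have *: "block m (g (h x)) = block m (g (h y)) \<longleftrightarrow> block m (g x) = block m (g y)"
    if "h \<in> N" "x \<in> {1..2 ^ n}" "y \<in> {1..2 ^ n}" for h x y
  proof -
    have "g (h z) = (g \<circ> h \<circ> inv' g) (g z)" for z
      by (simp add: permutes_inverses[OF g])
    moreover have "g \<circ> h \<circ> inv' g \<in> tree_auts n" using norm[OF that(1)] N by blast
    ultimately show ?thesis
      using tree_autsD(2)[of "g \<circ> h \<circ> inv' g" n "g x" "g y" m] that(2,3) g_in by simp
  qed
  define c where "c u = block m (g (Suc u))" for u
  have "\<exists>j\<le>n. \<forall>u<2 ^ n. \<forall>v<2 ^ n. c u = c v \<longleftrightarrow> drop_bit j u = drop_bit j v"
  proof (rule drop_bit_levels_if_invariant_colouring)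
    show "c (u XOR a) = c (v XOR a) \<longleftrightarrow> c u = c v"
      if "a < 2 ^ n" "u < 2 ^ n" "v < 2 ^ n" for a u v
      using *[OF transl[OF that(1)], of "Suc u" "Suc v"] that(2,3)
      by (simp add: c_def on_points_def Suc_le_eq)
    show "c (elem_transvection i w u) = c (elem_transvection i w v) \<longleftrightarrow> c u = c v"
      if "i < n" "w < 2 ^ i" "u < 2 ^ n" "v < 2 ^ n" for i w u v
      using *[OF transv[OF that(1,2)], of "Suc u" "Suc v"] that(3,4)
      by (simp add: c_def on_points_def Suc_le_eq)
  qed
  then obtain j where j: "j \<le> n"
    "\<And>u v. u < 2 ^ n \<Longrightarrow> v < 2 ^ n \<Longrightarrow> c u = c v \<longleftrightarrow> drop_bit j u = drop_bit j v" by blast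
  have x': "x - 1 < 2 ^ n" "Suc (x - 1) = x" and y': "y - 1 < 2 ^ n" "Suc (y - 1) = y"
    using xy by auto
  show "block m (g x) = block m (g y) \<longleftrightarrow> block m x = block m y"
  proof (cases "m \<le> n")
    case True
    have bij: "bij_betw (\<lambda>u. g (Suc u) - 1) {..<2 ^ n} {..<2 ^ n}"
    proof -
      have "bij_betw g {1..2 ^ n} {1..2 ^ n}" by (rule permutes_imp_bij[OF g])
      moreover have "bij_betw Suc {..<2 ^ n} {1..2 ^ n}"
        by (intro bij_betwI[of _ _ _ "\<lambda>x. x - 1"]) auto
      moreover have "bij_betw (\<lambda>x::nat. x - 1) {1..2 ^ n} {..<2 ^ n}"
        by (intro bij_betwI[of _ _ _ Suc]) auto
      ultimately show ?thesis
        using bij_betw_trans[of Suc "{..<2 ^ n}" "{1..2 ^ n}" g "{1..2 ^ n}"]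
          bij_betw_trans[of "g \<circ> Suc" "{..<2 ^ n}" "{1..2 ^ n}" "\<lambda>x. x - 1" "{..<2 ^ n}"]
        by (simp add: comp_def)
    qed
    define b where "b = g (Suc (x - 1)) - 1"
    have b: "b < 2 ^ n" unfolding b_def using bij_betwE[OF bij] x'(1) by blast
    have "2 ^ j = card {u. u < 2 ^ n \<and> drop_bit j u = drop_bit j (x - 1)}"
      using card_block[OF j(1) x'(1)] by simp
    also have "{u. u < 2 ^ n \<and> drop_bit j u = drop_bit j (x - 1)} =
        {u \<in> {..<2 ^ n}. drop_bit m (g (Suc u) - 1) = drop_bit m b}"
      using j(2)[of _ "x - 1"] x'(1) by (auto simp: c_def block_def b_def)
    also have "card \<dots> = card {v. v < 2 ^ n \<and> drop_bit m v = drop_bit m b}"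
    proof (rule bij_betw_same_card[of "\<lambda>u. g (Suc u) - 1"])
      show "bij_betw (\<lambda>u. g (Suc u) - 1)
          {u \<in> {..<2 ^ n}. drop_bit m (g (Suc u) - 1) = drop_bit m b}
          {v. v < 2 ^ n \<and> drop_bit m v = drop_bit m b}"
        using bij_betw_Collect[OF bij, of "\<lambda>v. drop_bit m v = drop_bit m b"
            "\<lambda>u. drop_bit m (g (Suc u) - 1) = drop_bit m b"] by simp
    qed
    also have "\<dots> = 2 ^ m" by (rule card_block[OF True b])
    finally have "j = m" by simp
    then show ?thesis using j(2)[OF x'(1) y'(1)] x' y' by (simp add: c_def block_def)
  next
    case False
    then have "block m z = 0" if "z \<in> {1..2 ^ n}" for z
    proof -
      have "(2::nat) ^ n \<le> 2 ^ m" using False by simp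
      then have "z - 1 < 2 ^ m" using that unfolding atLeastAtMost_iff by linarith
      then show ?thesis by (simp add: block_def less_two_power_iff_drop_bit)
    qed
    then show ?thesis using xy g_in by simp
  qed
qed

section \<open>The generated group is the automorphism group of the tree\<close>

lemma foldr_comp_id: "foldr (\<circ>) fs f = foldr (\<circ>) fs id \<circ> f"
  by (induction fs) (simp_all add: comp_assoc)

text \<open>
  The hypothesis \<open>k \<le> d\<close> makes the transpositions disjoint.
\<close>

lemma foldr_transpose_shift:
  fixes k d x :: nat
  assumes "k \<le> d"
  shows "foldr (\<circ>) (map (\<lambda>j. transpose j (j + d)) [1..<k + 1]) id x =
    (if x \<in> {1..k} then x + d else if x \<in> {d + 1..d + k} then x - d else x)"
  using assms
proof (induction k arbitrary: x)
  case (Suc k)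
  have "foldr (\<circ>) (map (\<lambda>j. transpose j (j + d)) [1..<Suc k + 1]) id x =
      foldr (\<circ>) (map (\<lambda>j. transpose j (j + d)) [1..<k + 1]) id (transpose (k + 1) (k + 1 + d) x)"
    by (simp add: foldr_comp_id[of _ "transpose _ _"] del: comp_apply) simp
  also have "\<dots> = (if x \<in> {1..Suc k} then x + d else if x \<in> {d + 1..d + Suc k} then x - d else x)"
    using Suc.prems by (subst Suc.IH) (auto simp: transpose_def)
  finally show ?case .
qed simp

lemma s_Suc_apply:
  "s (Suc n) x = (if x \<in> {1..2 ^ n} then x + 2 ^ n
     else if x \<in> {2 ^ n + 1..2 ^ n + 2 ^ n} then x - 2 ^ n else x)"
  unfolding s_def diff_Suc_1 by (rule foldr_transpose_shift) simp

lemma point_cases: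
  fixes x :: nat
  obtains "x = 0" | "x \<in> {1..2 ^ n}" | "x \<in> {2 ^ n + 1..2 ^ n + 2 ^ n}" | "x > 2 ^ Suc n"
proof -
  have "x = 0 \<or> x \<in> {1..2 ^ n} \<or> x \<in> {2 ^ n + 1..2 ^ n + 2 ^ n} \<or> x > 2 ^ Suc n"
    by auto
  then show ?thesis using that by blast
qed

lemma s_Suc_eq_translation: "s (Suc n) = translation (Suc n) (2 ^ n)"
proof
  fix x
  show "s (Suc n) x = translation (Suc n) (2 ^ n) x"
  proof (cases x rule: point_cases[where n = n])
    case 2
    then have "(x - 1) XOR 2 ^ n = x - 1 + 2 ^ n"
      by (intro xor_two_power_lower) auto
    with 2 show ?thesis
      by (auto simp: s_Suc_apply on_points_def)
  next
    case 3
    then have "(x - 1) XOR 2 ^ n = x - 1 - 2 ^ n"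
      by (intro xor_two_power_upper) auto
    with 3 show ?thesis
      by (auto simp: s_Suc_apply on_points_def)
  qed (auto simp: s_Suc_apply on_points_def)
qed

lemma s_Suc_involution: "s (Suc n) (s (Suc n) x) = x"
  by (auto simp: s_Suc_apply)

text \<open>
  A pair of permutations of the first \<open>2 ^ n\<close> points acting on the two halves of the first
  \<open>2 ^ Suc n\<close> points, the second one shifted. Both components fix 0 and all points above \<open>2 ^ n\<close>, so no
  further case distinction is needed.
\<close>

definition join :: "nat \<Rightarrow> (nat \<Rightarrow> nat) \<Rightarrow> (nat \<Rightarrow> nat) \<Rightarrow> nat \<Rightarrow> nat"
  where "join n g h x = (if x \<le> 2 ^ n then g x else h (x - 2 ^ n) + 2 ^ n)"

lemma join_id_right:
  assumes "g permutes {1..2 ^ n}"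
  shows "join n g id = g"
proof
  fix x show "join n g id x = g x"
    using permutes_not_in[OF assms, of x] by (auto simp: join_def)
qed

text \<open>
  Conjugation with \<open>s (Suc n)\<close>, which swaps the halves, moves \<open>h\<close> to the upper half. This expresses
  \<open>join\<close> through the generators.
\<close>

lemma join_eq_comp:
  assumes g: "g permutes {1..2 ^ n}" and h: "h permutes {1..2 ^ n}"
  shows "join n g h = g \<circ> (s (Suc n) \<circ> h \<circ> s (Suc n))"
proof
  fix x
  have h_in: "h y \<in> {1..2 ^ n} \<longleftrightarrow> y \<in> {1..2 ^ n}" for y by (rule permutes_in_image[OF h])
  have g_out: "g y = y" if "y \<notin> {1..2 ^ n}" for y using permutes_not_in[OF g that] .
  have h_out: "h y = y" if "y \<notin> {1..2 ^ n}" for y using permutes_not_in[OF h that] .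
  show "join n g h x = (g \<circ> (s (Suc n) \<circ> h \<circ> s (Suc n))) x"
  proof (cases x rule: point_cases[where n = n])
    case 1
    then show ?thesis using g_out[of 0] h_out[of 0] by (simp add: join_def s_Suc_apply)
  next
    case 2
    then show ?thesis using h_out[of "x + 2 ^ n"] by (simp add: join_def s_Suc_apply)
  next
    case 3
    then have "x - 2 ^ n \<in> {1..2 ^ n}" by auto
    then have "h (x - 2 ^ n) \<in> {1..2 ^ n}" using h_in by blast
    then show ?thesis using 3 g_out[of "h (x - 2 ^ n) + 2 ^ n"]
      by (simp add: join_def s_Suc_apply)
  next
    case 4
    then have "h (x - 2 ^ n) = x - 2 ^ n" by (intro h_out) auto
    then show ?thesis using 4 g_out[of x] h_out[of x]
      by (auto simp: join_def s_Suc_apply)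
  qed
qed

lemma block_zero_if_low:
  assumes "x \<in> {1..2 ^ n}" "n \<le> m"
  shows "block m x = 0"
proof -
  have "(2::nat) ^ n \<le> 2 ^ m" using assms(2) by simp
  then have "x - 1 < 2 ^ m" using assms(1) unfolding atLeastAtMost_iff by linarith
  then show ?thesis by (simp add: block_def less_two_power_iff_drop_bit)
qed

lemma block_shift:
  assumes "1 \<le> x" "m \<le> n"
  shows "block m (x + 2 ^ n) = block m x + 2 ^ (n - m)"
proof -
  have "(2::nat) ^ n = 2 ^ (n - m) * 2 ^ m"
    using assms(2) by (simp flip: power_add)
  then have "(x - 1 + 2 ^ n) div 2 ^ m = (x - 1) div 2 ^ m + 2 ^ (n - m)" by simp
  then show ?thesis using assms(1) by (simp add: block_def drop_bit_eq_div)
qed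

lemma block_less:
  assumes "x \<in> {1..2 ^ n}" "m \<le> n"
  shows "block m x < 2 ^ (n - m)"
proof -
  have "(2::nat) ^ n = 2 ^ (n - m) * 2 ^ m"
    using assms(2) by (simp flip: power_add)
  moreover have "x - 1 < 2 ^ n" using assms(1) by auto
  ultimately show ?thesis by (simp add: block_def drop_bit_eq_div less_mult_imp_div_less)
qed

text \<open>
  Below the root, two points of the same half are compared by the component acting on that half, and
  points of different halves never share a block.
\<close>

lemma join_in_tree_auts:
  assumes g: "g \<in> tree_auts n" and h: "h \<in> tree_auts n"
  shows "join n g h \<in> tree_auts (Suc n)"
proof (rule tree_autsI)
  have g_in: "g y \<in> {1..2 ^ n} \<longleftrightarrow> y \<in> {1..2 ^ n}" for y
    by (rule permutes_in_image[OF tree_autsD(1)[OF g]])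
  have h_in: "h y \<in> {1..2 ^ n} \<longleftrightarrow> y \<in> {1..2 ^ n}" for y
    by (rule permutes_in_image[OF tree_autsD(1)[OF h]])
  have split: "x \<in> {1..2 ^ n} \<or> (\<exists>y \<in> {1..2 ^ n}. x = y + 2 ^ n)" if "x \<in> {1..2 ^ Suc n}" for x :: nat
  proof (cases "x \<le> 2 ^ n")
    case False
    then have "x - 2 ^ n \<in> {1..2 ^ n}" "x = x - 2 ^ n + 2 ^ n" using that by auto
    then show ?thesis by blast
  qed (use that in auto)
  have low: "join n g h x = g x" if "x \<in> {1..2 ^ n}" for x
    using that by (simp add: join_def)
  have up: "join n g h (x + 2 ^ n) = h x + 2 ^ n" if "x \<in> {1..2 ^ n}" for x
    using that by (simp add: join_def)
  have low_in: "x \<in> {1..2 ^ Suc n}" and up_in: "x + 2 ^ n \<in> {1..2 ^ Suc n}"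
    if "x \<in> {1..2 ^ n}" for x :: nat using that by auto
  show join_in: "join n g h x \<in> {1..2 ^ Suc n}" if x: "x \<in> {1..2 ^ Suc n}" for x
    using split[OF x]
  proof
    assume x: "x \<in> {1..2 ^ n}"
    then show ?thesis unfolding low[OF x] using g_in by (intro low_in) blast
  next
    assume "\<exists>y \<in> {1..2 ^ n}. x = y + 2 ^ n"
    then obtain y where y: "y \<in> {1..2 ^ n}" "x = y + 2 ^ n" by blast
    show ?thesis unfolding y(2) up[OF y(1)] using y(1) h_in by (intro up_in) blast
  qed
  show "join n g h x = x" if x: "x \<notin> {1..2 ^ Suc n}" for x
  proof -
    have "x \<notin> {1..2 ^ n}" "x > 2 ^ n \<Longrightarrow> x - 2 ^ n \<notin> {1..2 ^ n}" using x by auto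
    then show ?thesis
      using permutes_not_in[OF tree_autsD(1)[OF g], of x]
        permutes_not_in[OF tree_autsD(1)[OF h], of "x - 2 ^ n"]
      by (simp add: join_def)
  qed
  show "block m (join n g h x) = block m (join n g h y) \<longleftrightarrow> block m x = block m y"
    if x: "x \<in> {1..2 ^ Suc n}" and y: "y \<in> {1..2 ^ Suc n}" for m x y
  proof (cases "m \<le> n")
    case False
    then show ?thesis
      using join_in[OF x] join_in[OF y] x y block_zero_if_low[of _ "Suc n" m] by simp
  next
    case True
    have shift: "block m (z + 2 ^ n) = block m z + 2 ^ (n - m)" if "z \<in> {1..2 ^ n}" for z
      using that block_shift[OF _ True] by simp
    have less: "block m z < 2 ^ (n - m)" if "z \<in> {1..2 ^ n}" for z
      using that block_less[OF _ True] by simp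
    \<comment> \<open>No block of level \<open>m \<le> n\<close> meets both halves.\<close>
    have mixed: "block m z \<noteq> block m (z' + 2 ^ n)" if "z \<in> {1..2 ^ n}" "z' \<in> {1..2 ^ n}" for z z'
      using less[OF that(1)] shift[OF that(2)] by simp
    consider (ll) "x \<in> {1..2 ^ n}" "y \<in> {1..2 ^ n}"
      | (lu) y' where "x \<in> {1..2 ^ n}" "y' \<in> {1..2 ^ n}" "y = y' + 2 ^ n"
      | (ul) x' where "x' \<in> {1..2 ^ n}" "x = x' + 2 ^ n" "y \<in> {1..2 ^ n}"
      | (uu) x' y' where "x' \<in> {1..2 ^ n}" "x = x' + 2 ^ n" "y' \<in> {1..2 ^ n}" "y = y' + 2 ^ n"
      using split[OF x] split[OF y] by blast
    then show ?thesis
    proof cases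
      case ll
      then show ?thesis using tree_autsD(2)[OF g ll] by (simp only: low)
    next
      case lu
      have "g x \<in> {1..2 ^ n}" "h y' \<in> {1..2 ^ n}" using lu g_in h_in by blast+
      then show ?thesis using mixed lu by (simp only: low up)
    next
      case ul
      have "g y \<in> {1..2 ^ n}" "h x' \<in> {1..2 ^ n}" using ul g_in h_in by blast+
      then show ?thesis using mixed[symmetric] ul by (simp only: low up)
    next
      case uu
      have "h x' \<in> {1..2 ^ n}" "h y' \<in> {1..2 ^ n}" using uu h_in by blast+
      then show ?thesis using tree_autsD(2)[OF h uu(1,3)] uu by (simp add: up shift)
    qed
  qed
qed

lemma tree_auts_mono: "m \<le> n \<Longrightarrow> tree_auts m \<subseteq> tree_auts n"
proof (induction n rule: dec_induct)
  case (step n)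
  have "id \<in> tree_auts n"
    using subgroup.one_closed[OF subgroup_tree_auts] by (simp add: sym_group_one)
  then have "g \<in> tree_auts (Suc n)" if "g \<in> tree_auts n" for g
    using join_in_tree_auts[OF that] join_id_right[OF tree_autsD(1)[OF that]] by metis
  then have "tree_auts n \<subseteq> tree_auts (Suc n)" by blast
  with step.IH show ?case by blast
qed simp

lemma s_in_tree_auts:
  assumes "i \<in> {1..n}"
  shows "s i \<in> tree_auts n"
proof -
  obtain j where j: "i = Suc j" using assms by (cases i) auto
  have "s i \<in> tree_auts i"
    unfolding j s_Suc_eq_translation by (rule translation_in_tree_auts) simp
  then show ?thesis using tree_auts_mono[of i n] assms by auto
qed

lemma block_one: "block m 1 = 0"
  by (simp add: block_def)

text \<open>
  The two halves are the blocks of level \<open>n\<close>. An automorphism that leaves the point 1 in the lower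
  half therefore maps each half to itself and splits into its two restrictions.
\<close>

lemma tree_aut_decomposition:
  assumes f: "f \<in> tree_auts (Suc n)" and f1: "f 1 \<le> 2 ^ n"
  obtains g h where "g \<in> tree_auts n" "h \<in> tree_auts n" "f = join n g h"
proof
  have f_in: "f y \<in> {1..2 ^ Suc n} \<longleftrightarrow> y \<in> {1..2 ^ Suc n}" for y
    by (rule permutes_in_image[OF tree_autsD(1)[OF f]])
  have low_in: "x \<in> {1..2 ^ Suc n}" and up_in: "x + 2 ^ n \<in> {1..2 ^ Suc n}"
    if "x \<in> {1..2 ^ n}" for x :: nat using that by auto
  have one_in: "(1::nat) \<in> {1..2 ^ Suc n}" by simp
  have b0: "block n z = 0 \<longleftrightarrow> z \<le> 2 ^ n" if "z \<in> {1..2 ^ Suc n}" for z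
  proof -
    have "block n z = 0 \<longleftrightarrow> z - 1 < 2 ^ n" by (simp add: block_def less_two_power_iff_drop_bit)
    also have "\<dots> \<longleftrightarrow> z \<le> 2 ^ n" using that by auto
    finally show ?thesis .
  qed
  have half: "f x \<le> 2 ^ n \<longleftrightarrow> x \<le> 2 ^ n" if x: "x \<in> {1..2 ^ Suc n}" for x
  proof -
    have "f x \<in> {1..2 ^ Suc n}" "f 1 \<in> {1..2 ^ Suc n}" using f_in x one_in by blast+
    then show ?thesis
      using tree_autsD(2)[OF f x one_in, of n] b0[of "f x"] b0[of "f 1"] b0[OF x] f1
      by (simp add: block_one[simplified])
  qed
  define g where "g x = (if x \<le> 2 ^ n then f x else x)" for x
  define h where "h x = (if x \<in> {1..2 ^ n} then f (x + 2 ^ n) - 2 ^ n else x)" for x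
  have g_in: "f x \<in> {1..2 ^ n}" if "x \<in> {1..2 ^ n}" for x
  proof -
    have "f x \<in> {1..2 ^ Suc n}" using f_in low_in[OF that] by blast
    moreover have "f x \<le> 2 ^ n" using half[OF low_in[OF that]] that by simp
    ultimately show ?thesis by simp
  qed
  have h_in: "f (x + 2 ^ n) - 2 ^ n \<in> {1..2 ^ n}" "f (x + 2 ^ n) - 2 ^ n + 2 ^ n = f (x + 2 ^ n)"
    if "x \<in> {1..2 ^ n}" for x
  proof -
    have "f (x + 2 ^ n) \<in> {1..2 ^ Suc n}" using f_in up_in[OF that] by blast
    moreover have "\<not> f (x + 2 ^ n) \<le> 2 ^ n" using half[OF up_in[OF that]] that by simp
    ultimately show "f (x + 2 ^ n) - 2 ^ n \<in> {1..2 ^ n}"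
      "f (x + 2 ^ n) - 2 ^ n + 2 ^ n = f (x + 2 ^ n)" by auto
  qed
  have f_out: "f x = x" if "x \<notin> {1..2 ^ Suc n}" for x
    by (rule permutes_not_in[OF tree_autsD(1)[OF f] that])
  show "g \<in> tree_auts n"
  proof (rule tree_autsI)
    show "g x = x" if "x \<notin> {1..2 ^ n}" for x
      using that f_out[of 0] by (cases "x = 0") (auto simp: g_def)
  qed (use g_in tree_autsD(2)[OF f low_in low_in] in \<open>simp_all add: g_def\<close>)
  show "h \<in> tree_auts n"
  proof (rule tree_autsI)
    show "block m (h x) = block m (h y) \<longleftrightarrow> block m x = block m y"
      if x: "x \<in> {1..2 ^ n}" and y: "y \<in> {1..2 ^ n}" for m x y
    proof (cases "m \<le> n")
      case True
      have shift: "block m z = block m w \<longleftrightarrow> block m (z + 2 ^ n) = block m (w + 2 ^ n)"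
        if "z \<in> {1..2 ^ n}" "w \<in> {1..2 ^ n}" for z w
        using that block_shift[OF _ True] by simp
      show ?thesis
        using shift[OF x y] shift[OF h_in(1)[OF x] h_in(1)[OF y]]
          tree_autsD(2)[OF f up_in[OF x] up_in[OF y], of m] h_in(2)[OF x] h_in(2)[OF y] x y
        by (simp add: h_def)
    next
      case False
      then show ?thesis
        using x y h_in(1)[OF x] h_in(1)[OF y] block_zero_if_low[of _ n m] by (simp add: h_def)
    qed
  qed (use h_in(1) in \<open>auto simp: h_def\<close>)
  show "f = join n g h"
  proof
    fix x :: nat
    consider "x \<le> 2 ^ n" | "x - 2 ^ n \<in> {1..2 ^ n}" "x > 2 ^ n" | "x > 2 ^ Suc n"
      by force
    then show "f x = join n g h x"
    proof cases
      case 2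
      then show ?thesis using h_in(2)[OF 2(1)] by (simp add: join_def h_def)
    next
      case 3
      then show ?thesis using f_out[of x] by (auto simp: join_def h_def)
    qed (simp add: join_def g_def)
  qed
qed

lemma s_comp_in_tree_auts:
  assumes "f \<in> tree_auts (Suc n)"
  shows "s (Suc n) \<circ> f \<in> tree_auts (Suc n)"
  using assms by (intro comp_in_tree_auts s_in_tree_auts) auto

text \<open>
  The recursion of iterated wreath products: either the halves are preserved, or composing with
  \<open>s (Suc n)\<close> makes them so.
\<close>

lemma tree_auts_Suc:
  "tree_auts (Suc n) = case_prod (join n) ` (tree_auts n \<times> tree_auts n) \<union>
     (\<lambda>(g, h). s (Suc n) \<circ> join n g h) ` (tree_auts n \<times> tree_auts n)" (is "_ = ?A \<union> ?B")
proof
  show "?A \<union> ?B \<subseteq> tree_auts (Suc n)"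
    using join_in_tree_auts s_comp_in_tree_auts by auto
  show "tree_auts (Suc n) \<subseteq> ?A \<union> ?B"
  proof
    fix f assume f: "f \<in> tree_auts (Suc n)"
    show "f \<in> ?A \<union> ?B"
    proof (cases "f 1 \<le> 2 ^ n")
      case True
      then obtain g h where "g \<in> tree_auts n" "h \<in> tree_auts n" "f = join n g h"
        using tree_aut_decomposition[OF f] by blast
      then show ?thesis by (intro UnI1 image_eqI[of _ _ "(g, h)"]) auto
    next
      case False
      have "f 1 \<in> {1..2 ^ Suc n}"
        using permutes_in_image[OF tree_autsD(1)[OF f], of 1] by simp
      then have "(s (Suc n) \<circ> f) 1 \<le> 2 ^ n" using False by (simp add: s_Suc_apply)
      then obtain g h where gh: "g \<in> tree_auts n" "h \<in> tree_auts n" "s (Suc n) \<circ> f = join n g h"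
        using tree_aut_decomposition[OF s_comp_in_tree_auts[OF f]] by blast
      have "f = s (Suc n) \<circ> join n g h"
        unfolding gh(3)[symmetric] by (simp add: fun_eq_iff s_Suc_involution)
      then show ?thesis using gh(1,2) by (intro UnI2 image_eqI[of _ _ "(g, h)"]) auto
    qed
  qed
qed

text \<open>
  By the wreath recursion every automorphism of the tree of height \<open>Suc n\<close> is a product of
  \<open>s (Suc n)\<close> and of automorphisms of the lower half, which are generated by \<open>s 1, \<dots>, s n\<close>.
\<close>

lemma Sigma_grp_eq_tree_auts: "Sigma_grp n = tree_auts n"
proof
  interpret S: group "Sym2 n" for n by (rule sym_group_is_group)
  show "Sigma_grp n \<subseteq> tree_auts n"
    unfolding Sigma_grp_def using s_in_tree_auts
    by (intro S.generate_subgroup_incl subgroup_tree_auts) auto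
  show "tree_auts n \<subseteq> Sigma_grp n"
  proof (induction n)
    case 0
    have "g = id" if "g \<in> tree_auts 0" for g
      using tree_autsD(1)[OF that] by simp
    then show ?case
      using generate.one[of "Sym2 0" "s ` {1..0}"] by (auto simp: Sigma_grp_def sym_group_one)
  next
    case (Suc n)
    have gen_carrier: "s ` {1..m} \<subseteq> carrier (Sym2 m)" for m
      using s_in_tree_auts tree_autsD(1) by (fastforce simp: sym_group_carrier)
    have comp: "f \<circ> f' \<in> Sigma_grp (Suc n)" if "f \<in> Sigma_grp (Suc n)" "f' \<in> Sigma_grp (Suc n)" for f f' :: "nat \<Rightarrow> nat"
      using generate.eng[OF that[unfolded Sigma_grp_def]]
      by (simp add: Sigma_grp_def sym_group_mult)
    have s_in: "s (Suc n) \<in> Sigma_grp (Suc n)"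
      unfolding Sigma_grp_def by (intro generate.incl) auto
    have up: "Sigma_grp n \<subseteq> Sigma_grp (Suc n)"
    proof
      fix f assume "f \<in> Sigma_grp n"
      then show "f \<in> Sigma_grp (Suc n)"
        unfolding Sigma_grp_def
      proof (induction rule: generate.induct)
        case one
        then show ?case
          using generate.one[of "Sym2 (Suc n)" "s ` {1..Suc n}"] by (simp only: sym_group_one)
      next
        case (incl h)
        then show ?case by (intro generate.incl) auto
      next
        case (inv h)
        then have "h \<in> s ` {1..Suc n}" by auto
        then have "inv\<^bsub>Sym2 (Suc n)\<^esub> h \<in> generate (Sym2 (Suc n)) (s ` {1..Suc n})"
          by (rule generate.inv)
        moreover have "h \<in> carrier (Sym2 n)" "h \<in> carrier (Sym2 (Suc n))"
          using gen_carrier[of n] gen_carrier[of "Suc n"] inv \<open>h \<in> s ` {1..Suc n}\<close> by blast+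
        ultimately show ?case by simp
      next
        case (eng h1 h2)
        then show ?case
          using generate.eng[of h1 "Sym2 (Suc n)" "s ` {1..Suc n}" h2] by (simp only: sym_group_mult)
      qed
    qed
    have join_in: "join n g h \<in> Sigma_grp (Suc n)" if "g \<in> tree_auts n" "h \<in> tree_auts n" for g h
      unfolding join_eq_comp[OF tree_autsD(1)[OF that(1)] tree_autsD(1)[OF that(2)]]
      by (intro comp s_in subsetD[OF up] subsetD[OF Suc.IH] that)
    show ?case
      unfolding tree_auts_Suc using join_in comp[OF s_in] by auto
  qed
qed

lemma join_inj:
  assumes "join n g h = join n g' h'"
    and "g \<in> tree_auts n" "g' \<in> tree_auts n" "h \<in> tree_auts n" "h' \<in> tree_auts n"
  shows "g = g' \<and> h = h'"
proof -
  have p: "g permutes {1..2 ^ n}" "g' permutes {1..2 ^ n}" "h permutes {1..2 ^ n}" "h' permutes {1..2 ^ n}"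
    using assms(2-) tree_autsD(1) by blast+
  have "g x = g' x" for x
    using fun_cong[OF assms(1), of x] permutes_not_in[OF p(1), of x] permutes_not_in[OF p(2), of x]
    by (cases "x \<le> 2 ^ n") (auto simp: join_def)
  moreover have "h x = h' x" for x
    using fun_cong[OF assms(1), of "x + 2 ^ n"] permutes_not_in[OF p(3), of x]
      permutes_not_in[OF p(4), of x]
    by (cases "x = 0") (auto simp: join_def)
  ultimately show ?thesis by blast
qed

lemma card_tree_auts_Suc: "card (tree_auts (Suc n)) = 2 * (card (tree_auts n))\<^sup>2"
proof -
  let ?P = "tree_auts n \<times> tree_auts n"
  let ?A = "case_prod (join n) ` ?P" and ?B = "(\<lambda>(g, h). s (Suc n) \<circ> join n g h) ` ?P"
  have inj: "inj_on (case_prod (join n)) ?P"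
    by (rule inj_onI) (use join_inj in \<open>fast\<close>)
  have cancel: "f = f'" if "s (Suc n) \<circ> f = s (Suc n) \<circ> f'" for f f' :: "nat \<Rightarrow> nat"
  proof
    fix x :: nat
    have "s (Suc n) (s (Suc n) (f x)) = s (Suc n) (s (Suc n) (f' x))"
      using fun_cong[OF that, of x] by simp
    then show "f x = f' x" by (simp add: s_Suc_involution)
  qed
  have injB: "inj_on (\<lambda>(g, h). s (Suc n) \<circ> join n g h) ?P"
    by (rule inj_onI) (use join_inj cancel in \<open>fast\<close>)
  have low: "join n g h 1 \<in> {1..2 ^ n}" if "g \<in> tree_auts n" for g h
    using permutes_in_image[OF tree_autsD(1)[OF that], of 1] by (simp add: join_def)
  have "?A \<inter> ?B = {}"
  proof -
    have "join n g h \<noteq> s (Suc n) \<circ> join n g' h'"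
      if "g \<in> tree_auts n" "g' \<in> tree_auts n" for g h g' h'
    proof
      assume "join n g h = s (Suc n) \<circ> join n g' h'"
      then have "join n g h 1 = s (Suc n) (join n g' h' 1)" by simp
      then show False using low[OF that(1), of h] low[OF that(2), of h'] by (simp add: s_Suc_apply)
    qed
    then show ?thesis by fastforce
  qed
  then have "card (tree_auts (Suc n)) = card ?A + card ?B"
    unfolding tree_auts_Suc by (intro card_Un_disjoint) (simp_all add: finite_tree_auts)
  also have "\<dots> = 2 * (card (tree_auts n))\<^sup>2"
    by (simp add: card_image[OF inj] card_image[OF injB] card_cartesian_product power2_eq_square)
  finally show ?thesis .
qed

lemma card_tree_auts: "\<exists>m. card (tree_auts n) = 2 ^ m"
proof (induction n)
  case 0
  have "tree_auts 0 = {id}"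
    using tree_autsD(1)[of _ 0] subgroup.one_closed[OF subgroup_tree_auts[of 0]]
    by (auto simp: sym_group_one)
  then have "card (tree_auts 0) = 2 ^ 0" by simp
  then show ?case ..
next
  case (Suc n)
  then obtain m where "card (tree_auts n) = 2 ^ m" ..
  then have "card (tree_auts (Suc n)) = 2 ^ Suc (m * 2)"
    by (simp add: card_tree_auts_Suc power_mult)
  then show ?case ..
qed

section \<open>The regular elementary abelian group and its normalizer chain\<close>

text \<open>
  Passing from \<open>n\<close> to \<open>Suc n\<close> lets \<open>t n i\<close> act on both halves simultaneously. Adding a vector without
  coordinate \<open>n\<close> does the same, and \<open>s (Suc n)\<close> itself adds the basis vector of coordinate \<open>n\<close>.
\<close>

lemma t_eq_translation:
  assumes "i \<in> {1..n}"
  shows "t n i = translation n (2 ^ (i - 1))"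
  using assms
proof (induction n)
  case (Suc n)
  show ?case
  proof (cases "i = Suc n")
    case True
    then show ?thesis by (simp add: s_Suc_eq_translation)
  next
    case False
    then have i: "i \<in> {1..n}" using Suc.prems by simp
    define a :: nat where "a = 2 ^ (i - 1)"
    have a: "a < 2 ^ n" unfolding a_def using i by (intro power_strict_increasing) auto
    have IH: "t n i = translation n a" using Suc.IH[OF i] by (simp add: a_def)
    have tn: "t n i permutes {1..2 ^ n}"
      unfolding IH by (rule tree_autsD(1)[OF translation_in_tree_auts[OF a]])
    have s_carrier: "s (Suc n) \<in> carrier (Sym2 (Suc n))"
      using tree_autsD(1)[OF s_in_tree_auts[of "Suc n" "Suc n"]] by (simp add: sym_group_carrier)
    have "inv' (s (Suc n)) = s (Suc n)"
      by (rule inv_unique_comp) (simp_all add: fun_eq_iff s_Suc_involution)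
    then have "t (Suc n) i = join n (t n i) (t n i)"
      using False s_carrier join_eq_comp[OF tn tn]
      by (simp add: conj_by_def sym_group_mult)
    also have "\<dots> = translation (Suc n) a"
    proof
      fix x
      have less: "u XOR a < 2 ^ n" if "u < 2 ^ n" for u using xor_less_two_power that a by blast
      have up: "(u + 2 ^ n) XOR a = (u XOR a) + 2 ^ n" if "u < 2 ^ n" for u
      proof -
        have "(u + 2 ^ n) XOR a = (u XOR 2 ^ n) XOR a" by (simp add: xor_two_power_lower that)
        also have "\<dots> = (u XOR a) XOR 2 ^ n" by (simp add: ac_simps)
        also have "\<dots> = (u XOR a) + 2 ^ n" by (rule xor_two_power_lower[OF less[OF that]])
        finally show ?thesis .
      qed
      show "join n (t n i) (t n i) x = translation (Suc n) a x"
      proof (cases x rule: point_cases[where n = n])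
        case 3
        define u where "u = x - 1 - 2 ^ n"
        have u: "u < 2 ^ n" "x = Suc (u + 2 ^ n)" using 3 by (auto simp: u_def)
        show ?thesis
          using up[OF u(1)] u by (simp add: IH join_def on_points_def)
      qed (auto simp: IH join_def on_points_def)
    qed
    finally show ?thesis by (simp add: a_def)
  qed
qed simp

lemma translation_comp:
  assumes "b < 2 ^ n"
  shows "translation n a \<circ> translation n b = translation n (a XOR b)"
  by (subst on_points_comp) (auto simp: assms xor_less_two_power comp_def ac_simps)

lemma on_points_id: "on_points n (\<lambda>u. u) = id"
  by (auto simp: on_points_def fun_eq_iff)

lemma inv_translation:
  assumes "a < 2 ^ n"
  shows "inv' (translation n a) = translation n a"
  by (rule inv_unique_comp) (simp_all add: translation_comp assms on_points_id)

lemma subgroup_translations: "subgroup (translation n ` {..<2 ^ n}) (Sym2 n)"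
proof
  show sub: "translation n ` {..<2 ^ n} \<subseteq> carrier (Sym2 n)"
    using tree_autsD(1)[OF translation_in_tree_auts] by (auto simp: sym_group_carrier)
  show "\<one>\<^bsub>Sym2 n\<^esub> \<in> translation n ` {..<2 ^ n}"
  proof -
    have "translation n 0 \<in> translation n ` {..<2 ^ n}" by (rule imageI) simp
    then show ?thesis by (simp add: sym_group_one on_points_id)
  qed
  show "x \<otimes>\<^bsub>Sym2 n\<^esub> y \<in> translation n ` {..<2 ^ n}"
    if "x \<in> translation n ` {..<2 ^ n}" "y \<in> translation n ` {..<2 ^ n}" for x y
    using that by (auto simp: sym_group_mult translation_comp xor_less_two_power)
  show "inv\<^bsub>Sym2 n\<^esub> x \<in> translation n ` {..<2 ^ n}" if "x \<in> translation n ` {..<2 ^ n}" for x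
    using that sub by (auto simp: inv_translation)
qed

text \<open>
  The generators are the translations by the basis vectors.
\<close>

lemma T_grp_eq: "T_grp n = translation n ` {..<2 ^ n}"
proof
  interpret S: group "Sym2 n" by (rule sym_group_is_group)
  have pow: "2 ^ (i - 1) < (2::nat) ^ n" if "i \<in> {1..n}" for i
    using that by (intro power_strict_increasing) auto
  show "T_grp n \<subseteq> translation n ` {..<2 ^ n}"
    unfolding T_grp_def
    by (rule S.generate_subgroup_incl[OF _ subgroup_translations]) (use pow in \<open>auto simp: t_eq_translation\<close>)
  have "translation n a \<in> T_grp n" if "m \<le> n" "a < 2 ^ m" for m a
    using that
  proof (induction m arbitrary: a)
    case 0
    then show ?case
      using generate.one[of "Sym2 n" "t n ` {1..n}"]
      by (simp add: T_grp_def on_points_id sym_group_one id_def)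
  next
    case (Suc m)
    show ?case
    proof (cases "a < 2 ^ m")
      case False
      \<comment> \<open>Remove the leading bit of \<open>a\<close>.\<close>
      define b where "b = a XOR 2 ^ m"
      have "b = a - 2 ^ m" unfolding b_def using False Suc.prems(2) by (intro xor_two_power_upper) auto
      then have b: "b < 2 ^ m" using Suc.prems(2) False by simp
      have "translation n b \<in> T_grp n" using Suc.IH[of b] Suc.prems(1) b by simp
      moreover have "translation n (2 ^ m) \<in> T_grp n"
        unfolding T_grp_def using Suc.prems(1) t_eq_translation[of "Suc m" n]
        by (intro generate.incl image_eqI[of _ _ "Suc m"]) auto
      ultimately have "translation n b \<circ> translation n (2 ^ m) \<in> T_grp n"
        using generate.eng[of _ "Sym2 n"] by (simp add: T_grp_def sym_group_mult)
      moreover have "(2::nat) ^ m < 2 ^ n"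
        using Suc.prems(1) by (intro power_strict_increasing) auto
      ultimately show ?thesis by (simp add: translation_comp b_def xor.assoc)
    qed (use Suc in simp)
  qed
  then show "translation n ` {..<2 ^ n} \<subseteq> T_grp n" by blast
qed

lemma subgroup_normalizer:
  assumes "subgroup H (Sym2 n)"
  shows "subgroup (normalizer (Sym2 n) H) (Sym2 n)" "H \<subseteq> normalizer (Sym2 n) H"
proof -
  interpret S: group "Sym2 n" by (rule sym_group_is_group)
  show "subgroup (normalizer (Sym2 n) H) (Sym2 n)"
    using S.normalizer_imp_subgroup[OF subgroup.subset[OF assms]] .
  show "H \<subseteq> normalizer (Sym2 n) H"
    using subgroup.subset[OF normal_imp_subgroup[OF S.subgroup_in_normalizer[OF assms]]] by simp
qed

lemma mem_normalizer_Sym2_iff: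
  assumes "subgroup H (Sym2 n)"
  shows "g \<in> normalizer (Sym2 n) H \<longleftrightarrow>
    g permutes {1..2 ^ n} \<and> (\<forall>h\<in>H. g \<circ> h \<circ> inv' g \<in> H)"
proof -
  interpret S: group "Sym2 n" by (rule sym_group_is_group)
  have sub: "H \<subseteq> carrier (Sym2 n)" by (rule subgroup.subset[OF assms])
  have "finite (carrier (Sym2 n))"
    by (simp add: sym_group_def finite_permutations)
  then have "finite H" using sub finite_subset by blast
  show ?thesis
    unfolding S.normalizer_iff_if_finite[OF sub \<open>finite H\<close>] sym_group_mult
      sym_group_carrier[symmetric]
    by (cases "g \<in> carrier (Sym2 n)") simp_all
qed

lemma U_grp_eq: "U_grp n = tree_auts n \<inter> normalizer (Sym2 n) (T_grp n)"
  by (simp add: U_grp_def normalizer_in_def Sigma_grp_eq_tree_auts)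

lemma translation_in_U_grp:
  assumes "a < 2 ^ n"
  shows "translation n a \<in> U_grp n"
  using assms translation_in_tree_auts subgroup_normalizer(2)[OF subgroup_translations[of n]]
  by (auto simp: U_grp_eq T_grp_eq)

text \<open>
  Conjugating the translation by \<open>a\<close> with a linear map gives the translation by the image of \<open>a\<close>.
\<close>

lemma transvection_in_U_grp:
  assumes w: "w < 2 ^ i"
  shows "transvection n i w \<in> U_grp n"
proof -
  let ?\<tau> = "transvection n i w"
  have aut: "?\<tau> \<in> tree_auts n" by (rule transvection_in_tree_auts[OF w])
  have "?\<tau> \<circ> ?\<tau> = id"
    by (subst on_points_comp)
      (auto simp: elem_transvection_less[OF w] elem_transvection_involution[OF w] on_points_def fun_eq_iff)
  then have inv: "inv' ?\<tau> = ?\<tau>" by (intro inv_unique_comp)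
  have "?\<tau> \<circ> h \<circ> inv' ?\<tau> \<in> translation n ` {..<2 ^ n}" if "h \<in> translation n ` {..<2 ^ n}" for h
  proof -
    from that obtain a where a: "a < 2 ^ n" "h = translation n a" by auto
    have "?\<tau> \<circ> h = on_points n (elem_transvection i w \<circ> (\<lambda>u. u XOR a))"
      unfolding a(2) by (rule on_points_comp) (rule xor_less_two_power[OF _ a(1)])
    then have "?\<tau> \<circ> h \<circ> ?\<tau> = on_points n
        (elem_transvection i w \<circ> (\<lambda>u. u XOR a) \<circ> elem_transvection i w)"
      using on_points_comp[of n "elem_transvection i w", OF elem_transvection_less[OF w]] by simp
    also have "\<dots> = translation n (elem_transvection i w a)"
      by (simp add: comp_def elem_transvection_xor[OF w] elem_transvection_involution[OF w])
    finally show ?thesis using elem_transvection_less[OF w a(1)] by (simp add: inv)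
  qed
  then show ?thesis
    using aut tree_autsD(1)[OF aut]
    by (simp add: U_grp_eq T_grp_eq mem_normalizer_Sym2_iff[OF subgroup_translations])
qed

lemma normalizer_subset_tree_auts:
  assumes "subgroup N (Sym2 n)" "U_grp n \<subseteq> N" "N \<subseteq> tree_auts n"
  shows "normalizer (Sym2 n) N \<subseteq> tree_auts n"
  using tree_aut_if_normalizes[OF assms(3)] assms(2) translation_in_U_grp transvection_in_U_grp
  by (auto simp: mem_normalizer_Sym2_iff[OF assms(1)] subset_eq)

text \<open>
  The invariant behind the theorem. The lower bound provides the translations and transvections
  needed to see that the next normalizer still consists of automorphisms of the tree.
\<close>

lemma norm_chain_between:
  "subgroup (norm_chain n k) (Sym2 n) \<and> U_grp n \<subseteq> norm_chain n k \<and> norm_chain n k \<subseteq> tree_auts n"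
proof (induction k)
  case 0
  interpret S: group "Sym2 n" by (rule sym_group_is_group)
  have "subgroup (U_grp n) (Sym2 n)"
    unfolding U_grp_eq T_grp_eq
    by (intro S.subgroups_Inter_pair subgroup_tree_auts subgroup_normalizer subgroup_translations)
  then show ?case by (simp add: U_grp_eq)
next
  case (Suc k)
  then show ?case
    using subgroup_normalizer[of "norm_chain n k" n] normalizer_subset_tree_auts[of "norm_chain n k" n]
    by auto
qed

lemma is_p_group_if_subset_tree_auts:
  assumes "subgroup N (Sym2 n)" "N \<subseteq> tree_auts n"
  shows "is_p_group 2 ((Sym2 n)\<lparr>carrier := N\<rparr>)"
proof -
  interpret S: group "Sym2 n" by (rule sym_group_is_group)
  interpret A: group "(Sym2 n)\<lparr>carrier := tree_auts n\<rparr>"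
    by (rule S.subgroup_imp_group[OF subgroup_tree_auts])
  have "subgroup N ((Sym2 n)\<lparr>carrier := tree_auts n\<rparr>)"
    by (rule S.subgroup_incl[OF assms(1) subgroup_tree_auts assms(2)])
  from A.lagrange[OF this] have "card (tree_auts n) = card (rcosets\<^bsub>(Sym2 n)\<lparr>carrier := tree_auts n\<rparr>\<^esub> N) * card N"
    by (simp add: order_def)
  then have "card N dvd card (tree_auts n)" by (rule dvdI[OF trans[OF _ mult.commute]])
  moreover obtain m where "card (tree_auts n) = 2 ^ m" using card_tree_auts by blast
  ultimately obtain l where "card N = 2 ^ l"
    using divides_primepow_nat[OF two_is_prime_nat] by auto
  then show ?thesis
    using S.subgroup_imp_group[OF assms(1)] by (auto simp: is_p_group_def order_def)
qed

theorem theorem3p2: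
  fixes n k :: nat
  assumes "k \<ge> 1"
  shows "norm_chain n k = normalizer_in (Sym2 n) (Sigma_grp n) (norm_chain n (k - 1)) \<and>
         is_p_group 2 ((Sym2 n)\<lparr>carrier := norm_chain n k\<rparr>)"
proof
  have "norm_chain n k = normalizer (Sym2 n) (norm_chain n (k - 1))"
    using assms by (cases k) auto
  then show "norm_chain n k = normalizer_in (Sym2 n) (Sigma_grp n) (norm_chain n (k - 1))"
    using norm_chain_between[of n k] by (auto simp: normalizer_in_def Sigma_grp_eq_tree_auts)
  show "is_p_group 2 ((Sym2 n)\<lparr>carrier := norm_chain n k\<rparr>)"
    using norm_chain_between[of n k] by (intro is_p_group_if_subset_tree_auts) auto
qed

end
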